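(* Suppose $N>2$ and $G$ is a strongly $(N-1)$-undetermined impartial game. Then $G+H$ is undetermined for every impartial game $H$.
   Context: All games are short impartial games (identified with the finite set of their options, no infinite runs); $+$ is the disjunctive sum. There are $N$ players moving cyclically; under normal play the player unable to move on their turn is the unique loser. Relative to a position the players are $\mathbf N=\mathbf O_0,\mathbf O_1,\dots,\mathbf O_{N-2},\mathbf P=\mathbf O_{N-1}$ ($\mathbf O_i$ moves $i$ turns after $\mathbf N$), and the outcome $o(G)$ is defined recursively: $\mathbf N\in o(G)$ iff some option $G'$ has $\mathbf P\in o(G')$; for $1\le i\le N-1$, $\mathbf O_i\in o(G)$ iff every option $G'$ has $\mathbf O_{i-1}\in o(G')$. A game $G$ is undetermined if $o(G)=\emptyset$. $G$ is $1$-undetermined if it is undetermined, and for $k>1$, $G$ is $k$-undetermined if it is undetermined and has an option that is $(k-1)$-undetermined. For $k>1$, $G$ is strongly $k$-undetermined if $G$ has at least one option and every option of $G$ is $(k-1)$-undetermined. *)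

theory Defs
  imports Main "HOL-Library.FSet"
begin

text \<open>Short impartial games, identified with the finite set of their options.
  Since this is a datatype, there are no infinite runs.\<close>

datatype game = Game (options: "game fset")

lemma size_option: "G' |\<in>| options G \<Longrightarrow> size G' < size G"
  by (cases G) (auto simp: less_Suc_eq_le sum.remove)

function game_sum :: "game \<Rightarrow> game \<Rightarrow> game"  (infixl "\<oplus>" 65) where
  "G \<oplus> H =
     Game ((\<lambda>G'. G' \<oplus> H) |`| options G |\<union>| (\<lambda>H'. G \<oplus> H') |`| options H)"
  by pat_completeness auto
termination
  by (relation "measure (\<lambda>(G, H). size G + size H)") (auto dest: size_option)

declare game_sum.simps [simp del]

text \<open>With \<open>N\<close> players, the index \<open>i < N\<close> stands for the player who moves \<open>i\<close> turns after the
  player to move: \<open>0\<close> is the next player and \<open>N - 1\<close> the previous player.\<close>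

function outcome :: "nat \<Rightarrow> game \<Rightarrow> nat set" where
  "outcome N G =
     {i. i = 0 \<and> (\<exists>G' |\<in>| options G. N - 1 \<in> outcome N G')} \<union>
     {i. 1 \<le> i \<and> i \<le> N - 1 \<and> (\<forall>G' |\<in>| options G. i - 1 \<in> outcome N G')}"
  by pat_completeness auto
termination
  by (relation "measure (\<lambda>(N, G). size G)") (auto dest: size_option)

declare outcome.simps [simp del]

definition undetermined :: "nat \<Rightarrow> game \<Rightarrow> bool" where
  "undetermined N G \<longleftrightarrow> outcome N G = {}"

text \<open>The notion is only meaningful for \<open>k \<ge> 1\<close>; the value at \<open>k = 0\<close> is a dummy.\<close>

fun k_undetermined :: "nat \<Rightarrow> nat \<Rightarrow> game \<Rightarrow> bool" where
  "k_undetermined N 0 G \<longleftrightarrow> False"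
| "k_undetermined N (Suc 0) G \<longleftrightarrow> undetermined N G"
| "k_undetermined N (Suc (Suc k)) G \<longleftrightarrow>
     undetermined N G \<and> (\<exists>G' |\<in>| options G. k_undetermined N (Suc k) G')"

definition strongly_k_undetermined :: "nat \<Rightarrow> nat \<Rightarrow> game \<Rightarrow> bool" where
  "strongly_k_undetermined N k G \<longleftrightarrow>
     k > 1 \<and> options G \<noteq> {||} \<and> (\<forall>G' |\<in>| options G. k_undetermined N (k - 1) G')"

end

theory Submission
  imports Defs
begin

text \<open>A player who is not in the outcome can be made to lose by the coalition of all the others.
  If the player loses moving first in \<open>H\<close> and loses in \<open>G\<close>, then he loses in \<open>G \<oplus> H\<close>: the coalition
  follows its strategy in \<open>G\<close> and always answers in the component in which the player just moved.
  The key step is that the previous player loses \<open>G \<oplus> H\<close> for every undetermined \<open>G\<close>. If either the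
  next or the previous player loses in \<open>H\<close>, the first remark applies.
  Otherwise the coalition moves in \<open>H\<close> from option to option, preserving that all players from the
  current seat of the player up to the last one survive in \<open>H\<close>; as the outcome of \<open>H\<close> never contains
  all players, the run reaches, before the player's turn, a position of \<open>H\<close> lost for the player to
  move, and the coalition then continues in \<open>G\<close>, where it wins from every seat.\<close>

lemma zero_in_outcome:
  "0 \<in> outcome N G \<longleftrightarrow> (\<exists>G' |\<in>| options G. N - 1 \<in> outcome N G')"
  by (subst outcome.simps) auto

lemma Suc_in_outcome:
  "Suc i \<in> outcome N G \<longleftrightarrow> Suc i \<le> N - 1 \<and> (\<forall>G' |\<in>| options G. i \<in> outcome N G')"
  by (subst outcome.simps) auto

lemma options_game_sum:
  "options (G \<oplus> H) = (\<lambda>G'. G' \<oplus> H) |`| options G |\<union>| (\<lambda>H'. G \<oplus> H') |`| options H"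
  by (subst game_sum.simps) simp

lemma game_sum_commute: "G \<oplus> H = H \<oplus> G"
proof (induction G H rule: game_sum.induct)
  case (1 G H)
  have "(\<lambda>G'. G' \<oplus> H) |`| options G = (\<lambda>G'. H \<oplus> G') |`| options G"
    and "(\<lambda>H'. G \<oplus> H') |`| options H = (\<lambda>H'. H' \<oplus> G) |`| options H"
    using 1 by (auto intro!: fset.map_cong0)
  then show ?case
    by (subst (1 2) game_sum.simps) (simp add: sup_commute)
qed

text \<open>Infinite descent: if all seats were in the outcome, the option witnessing seat
  \<open>0\<close> would again have all of them.\<close>

lemma outcome_not_full: "\<not> {..N - 1} \<subseteq> outcome N G"
proof (induction G rule: measure_induct_rule[of size])
  case (less G)
  show ?case
  proof
    assume full: "{..N - 1} \<subseteq> outcome N G"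
    then obtain G' where G': "G' |\<in>| options G" "N - 1 \<in> outcome N G'"
      using zero_in_outcome by blast
    have "i \<in> outcome N G'" if "i < N - 1" for i
    proof -
      have "Suc i \<in> outcome N G"
        using full that by auto
      then show ?thesis
        using G'(1) Suc_in_outcome by blast
    qed
    then have "{..N - 1} \<subseteq> outcome N G'"
      using G'(2) by (auto simp: le_less)
    then show False
      using less size_option[OF G'(1)] by blast
  qed
qed

lemma not_in_outcome_game_sum:
  assumes "i \<notin> outcome N G" and "0 \<notin> outcome N H"
  shows "i \<notin> outcome N (G \<oplus> H)"
  using assms
proof (induction "size G + size H" arbitrary: G H i rule: less_induct)
  case less
  show ?case
  proof (cases i)
    case 0
    have "N - 1 \<notin> outcome N (G' \<oplus> H)" if "G' |\<in>| options G" for G'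
      using that less 0 size_option[OF that] zero_in_outcome[of N G] by auto
    \<comment> \<open>The components swap roles: the player, now in seat \<open>N - 1\<close>, loses
      in \<open>H'\<close>, and \<open>0 \<notin> outcome N G\<close> makes \<open>G\<close> the one
      lost when moving first.\<close>
    moreover have "N - 1 \<notin> outcome N (G \<oplus> H')" if "H' |\<in>| options H" for H'
      using that less(1)[of H' G "N - 1"] less(2,3) 0 size_option[OF that]
        zero_in_outcome[of N H] game_sum_commute[of G H'] by auto
    ultimately show ?thesis
      using 0 by (auto simp: zero_in_outcome[of N "G \<oplus> H"] options_game_sum)
  next
    case (Suc j)
    show ?thesis
    proof (cases "i \<le> N - 1")
      case True
      then obtain G' where G': "G' |\<in>| options G" "j \<notin> outcome N G'"
        using less(2) Suc Suc_in_outcome[of j N G] by auto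
      then have "j \<notin> outcome N (G' \<oplus> H)"
        using less(1)[of G' H j] less(3) size_option[OF G'(1)] by simp
      then show ?thesis
        using G'(1) Suc by (auto simp: Suc_in_outcome options_game_sum)
    qed (use Suc Suc_in_outcome in auto)
  qed
qed

lemma undetermined_sum_not_in_outcome:
  assumes "undetermined N G" and "{i..N - 1} \<subseteq> outcome N H" and "i \<le> N - 1"
  shows "i \<notin> outcome N (G \<oplus> H)"
  using assms(2,3)
proof (induction i arbitrary: H)
  case 0
  then show ?case
    using outcome_not_full[of N H] by (simp add: atLeast0AtMost)
next
  case (Suc i)
  show ?case
  proof (cases "0 \<in> outcome N H")
    case True
    then obtain H' where H': "H' |\<in>| options H" "N - 1 \<in> outcome N H'"
      using zero_in_outcome by blast
    \<comment> \<open>Seats shift down by one and the witness fills the top seat, so the interval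
      grows to include \<open>i\<close>.\<close>
    have "j \<in> outcome N H'" if "i \<le> j" "j < N - 1" for j
    proof -
      have "Suc j \<in> outcome N H"
        using Suc.prems that by auto
      then show ?thesis
        using H'(1) Suc_in_outcome by blast
    qed
    then have "{i..N - 1} \<subseteq> outcome N H'"
      using H'(2) by (auto simp: le_less)
    then have "i \<notin> outcome N (G \<oplus> H')"
      using Suc by simp
    then show ?thesis
      using H'(1) by (auto simp: Suc_in_outcome options_game_sum)
  next
    case False
    then show ?thesis
      using assms(1) not_in_outcome_game_sum unfolding undetermined_def by blast
  qed
qed

lemma previous_not_in_outcome_undetermined_sum:
  assumes "undetermined N G"
  shows "N - 1 \<notin> outcome N (G \<oplus> H)"
proof (cases "N - 1 \<in> outcome N H")
  case True
  then show ?thesis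
    using undetermined_sum_not_in_outcome[OF assms, of "N - 1" H] by simp
next
  case False
  then have "N - 1 \<notin> outcome N (H \<oplus> G)"
    using assms not_in_outcome_game_sum unfolding undetermined_def by blast
  then show ?thesis
    by (simp add: game_sum_commute)
qed

text \<open>Seat \<open>0\<close> fails after a move in \<open>G\<close> because the previous player
  loses there, and after a move in \<open>H\<close> by induction. Any other seat needs just one bad
  option: any move in \<open>H\<close>, or a move in \<open>G\<close> once \<open>H\<close> has no
  options.\<close>

lemma undetermined_game_sum:
  assumes nonempty: "options G \<noteq> {||}"
    and und: "\<And>G'. G' |\<in>| options G \<Longrightarrow> undetermined N G'"
  shows "undetermined N (G \<oplus> H)"
proof (induction H rule: measure_induct_rule[of size])
  case (less H)
  have IH: "undetermined N (G \<oplus> H')" if "H' |\<in>| options H" for H'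
    using less size_option[OF that] by blast
  have "i \<notin> outcome N (G \<oplus> H)" for i
  proof (cases i)
    case 0
    then show ?thesis
      using IH und previous_not_in_outcome_undetermined_sum
      by (auto simp: zero_in_outcome options_game_sum undetermined_def)
  next
    case (Suc j)
    have "\<exists>K. K |\<in>| options (G \<oplus> H) \<and> j \<notin> outcome N K"
    proof (cases "options H = {||}")
      case True
      obtain G' where G': "G' |\<in>| options G"
        using nonempty by auto
      have "0 \<notin> outcome N H"
        using True by (simp add: zero_in_outcome)
      then have "j \<notin> outcome N (G' \<oplus> H)"
        using und[OF G'] not_in_outcome_game_sum unfolding undetermined_def by blast
      then show ?thesis
        using G' by (auto simp: options_game_sum)
    next
      case False
      then obtain H' where "H' |\<in>| options H"
        by auto
      then show ?thesis
        using IH[of H'] by (auto simp: options_game_sum undetermined_def)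
    qed
    then show ?thesis
      using Suc Suc_in_outcome by blast
  qed
  then show ?case
    unfolding undetermined_def by blast
qed

lemma k_undetermined_imp_undetermined: "k_undetermined N k G \<Longrightarrow> undetermined N G"
  by (induction N k G rule: k_undetermined.induct) auto

theorem mainTheorem10:
  fixes N :: nat and G H :: game
  assumes "N > 2"
    and "strongly_k_undetermined N (N - 1) G"
  shows "undetermined N (G \<oplus> H)"
  using assms(2) k_undetermined_imp_undetermined undetermined_game_sum
  unfolding strongly_k_undetermined_def by blast

end
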